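(* If a family $\mathscr{F}$ of subsets of a set $X$ is Noetherian, then $$\eta^\infty(X,\mathscr{F})=\eta(X,\mathscr{F}).$$
   Context: The colorful Helly number $\eta(X,\mathscr{F})$ is the minimum positive integer $\eta$ for which the following holds: if finite subfamilies $\mathscr{F}_1,\ldots,\mathscr{F}_\eta\subset\mathscr{F}$ are such that $\bigcap_{F\in\mathscr{F}_i}F=\emptyset$ for every $i=1,\ldots,\eta$, then there exist $F_i\in\mathscr{F}_i$ ($1\le i\le\eta$) such that $F_1\cap\cdots\cap F_\eta=\emptyset$. If no such integer exists, $\eta(X,\mathscr{F})=\infty$. The number $\eta^\infty(X,\mathscr{F})$ is the colorful Helly number with the finiteness assumption on the subfamilies $\mathscr{F}_i$ removed (again with value $\infty$ if no such integer exists). The family $\mathscr{F}$ is called Noetherian if for any sequence of sets $F_1,F_2,\ldots$ in $\mathscr{F}$, the descending chain of sets $F_1\supset F_1\cap F_2\supset F_1\cap F_2\cap F_3\supset\cdots$ stabilizes. *)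

theory Defs
  imports Main "HOL-Library.Extended_Nat"
begin

text \<open>
  Throughout, \<open>\<F>\<close> is a family of subsets of the ground set \<open>X\<close>, and the intersection of a
  subfamily \<open>\<A>\<close> is taken inside \<open>X\<close>: writing it as \<open>X \<inter> \<Inter>\<A>\<close> makes the empty subfamily
  intersect to \<open>X\<close> (the bare \<open>\<Inter>{}\<close> would be the whole type).
\<close>

text \<open>
  The colourful Helly property for \<open>n\<close> colour classes, where the classes \<open>\<A> 1, \<dots>, \<A> n\<close>
  range over a collection \<open>\<C>\<close> of admissible subfamilies. They need not be distinct.
\<close>

definition colorful_helly_property :: "'a set \<Rightarrow> 'a set set set \<Rightarrow> nat \<Rightarrow> bool" where
  "colorful_helly_property X \<C> n \<longleftrightarrow>
     (\<forall>\<A> :: nat \<Rightarrow> 'a set set.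
        (\<forall>i\<in>{1..n}. \<A> i \<in> \<C> \<and> X \<inter> \<Inter>(\<A> i) = {}) \<longrightarrow>
        (\<exists>F :: nat \<Rightarrow> 'a set. (\<forall>i\<in>{1..n}. F i \<in> \<A> i) \<and> (\<Inter>i\<in>{1..n}. F i) = {}))"

definition least_positive :: "(nat \<Rightarrow> bool) \<Rightarrow> enat" where
  "least_positive P = (if \<exists>n>0. P n then enat (LEAST n. n > 0 \<and> P n) else \<infinity>)"

definition colorful_helly_number :: "'a set \<Rightarrow> 'a set set \<Rightarrow> enat" where
  "colorful_helly_number X \<F> =
     least_positive (colorful_helly_property X {\<A>. \<A> \<subseteq> \<F> \<and> finite \<A>})"

definition colorful_helly_number_inf :: "'a set \<Rightarrow> 'a set set \<Rightarrow> enat" where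
  "colorful_helly_number_inf X \<F> =
     least_positive (colorful_helly_property X {\<A>. \<A> \<subseteq> \<F>})"

definition noetherian_family :: "'a set set \<Rightarrow> bool" where
  "noetherian_family \<F> \<longleftrightarrow>
     (\<forall>F :: nat \<Rightarrow> 'a set. (\<forall>i. F i \<in> \<F>) \<longrightarrow>
        (\<exists>N. \<forall>n\<ge>N. (\<Inter>i\<in>{..n}. F i) = (\<Inter>i\<in>{..N}. F i)))"

end

theory Submission
  imports Defs
begin

text \<open>
  In a Noetherian family every intersection, however large, is already the intersection of finitely
  many of its members: otherwise one could keep choosing a member that does not contain the
  intersection of those chosen before, and the partial intersections would strictly decrease for
  ever (\<open>noetherian_family_finite_subfamily\<close>). An infinite colour class with empty intersection
  therefore contains a finite one with empty intersection, and a rainbow selection from the finite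
  classes is also one from the original classes. Hence the two colourful Helly properties agree for
  each number of colours separately, and so do the least numbers for which they hold.
\<close>

text \<open>
  If no finite \<open>\<B>\<close> had the same intersection as \<open>\<A>\<close>, each would miss some member of \<open>\<A>\<close>, in the
  sense that \<open>\<Inter>\<B>\<close> is not contained in it. Adding such members one at a time to the empty
  subfamily gives a sequence that violates the chain condition.
\<close>

lemma noetherian_family_finite_subfamily:
  assumes "noetherian_family \<F>" and "\<A> \<subseteq> \<F>"
  shows "\<exists>\<B>\<subseteq>\<A>. finite \<B> \<and> \<Inter>\<B> = \<Inter>\<A>"
proof (rule ccontr)
  assume no_finite: "\<not> ?thesis"
  have "\<exists>F\<in>\<A>. \<not> \<Inter>\<B> \<subseteq> F" if "\<B> \<subseteq> \<A>" "finite \<B>" for \<B>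
    using no_finite that by (metis Inf_greatest Inf_superset_mono subset_antisym)
  then obtain g where g: "g \<B> \<in> \<A>" "\<not> \<Inter>\<B> \<subseteq> g \<B>" if "\<B> \<subseteq> \<A>" "finite \<B>" for \<B>
    by metis
  define \<S> where "\<S> n = ((\<lambda>\<B>. insert (g \<B>) \<B>) ^^ n) {}" for n
  define F where "F n = g (\<S> n)" for n
  have \<S>_Suc: "\<S> (Suc n) = insert (F n) (\<S> n)" for n
    by (simp add: \<S>_def F_def)
  have \<S>: "\<S> n \<subseteq> \<A> \<and> finite (\<S> n)" for n
  proof (induction n)
    case 0
    show ?case by (simp add: \<S>_def)
  next
    case (Suc n)
    then show ?case using g(1)[of "\<S> n"] by (simp add: \<S>_Suc F_def)
  qed
  have \<S>_image: "\<S> (Suc n) = F ` {..n}" for n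
  proof (induction n)
    case 0
    show ?case by (simp add: \<S>_def F_def)
  next
    case (Suc n)
    then show ?case using \<S>_Suc[of "Suc n"] by (simp add: atMost_Suc)
  qed
  have "\<forall>i. F i \<in> \<F>"
    using g(1) \<S> assms(2) unfolding F_def by blast
  then obtain N where N: "\<And>n. n \<ge> N \<Longrightarrow> (\<Inter>i\<in>{..n}. F i) = (\<Inter>i\<in>{..N}. F i)"
    using assms(1)[unfolded noetherian_family_def, rule_format, of F] by auto
  have "\<Inter>(\<S> (Suc N)) = (\<Inter>i\<in>{..Suc N}. F i)"
    using N[of "Suc N"] unfolding \<S>_image by simp
  also have "\<dots> \<subseteq> F (Suc N)"
    by blast
  finally show False
    using g(2)[of "\<S> (Suc N)"] \<S>[of "Suc N"] by (simp add: F_def)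
qed

text \<open>
  Shrinking the colour classes only makes a rainbow selection harder to find, so the property
  passes to any collection whose classes with empty intersection contain classes from \<open>\<C>\<close> with
  empty intersection. Enlarging the collection to all subfamilies and restricting it to the finite
  ones are both of this kind.
\<close>

lemma colorful_helly_property_refine:
  assumes "colorful_helly_property X \<C> n"
    and refine: "\<And>\<A>. \<A> \<in> \<D> \<Longrightarrow> X \<inter> \<Inter>\<A> = {} \<Longrightarrow> \<exists>\<B>\<in>\<C>. \<B> \<subseteq> \<A> \<and> X \<inter> \<Inter>\<B> = {}"
  shows "colorful_helly_property X \<D> n"
  unfolding colorful_helly_property_def
proof (intro allI impI)
  fix \<A> :: "nat \<Rightarrow> 'a set set"
  assume "\<forall>i\<in>{1..n}. \<A> i \<in> \<D> \<and> X \<inter> \<Inter>(\<A> i) = {}"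
  then have "\<forall>i\<in>{1..n}. \<exists>\<B>. \<B> \<in> \<C> \<and> \<B> \<subseteq> \<A> i \<and> X \<inter> \<Inter>\<B> = {}"
    using refine by blast
  then obtain \<B> where \<B>: "\<forall>i\<in>{1..n}. \<B> i \<in> \<C> \<and> \<B> i \<subseteq> \<A> i \<and> X \<inter> \<Inter>(\<B> i) = {}"
    by metis
  then obtain F where F: "\<forall>i\<in>{1..n}. F i \<in> \<B> i" "(\<Inter>i\<in>{1..n}. F i) = {}"
    using assms(1)[unfolded colorful_helly_property_def, rule_format, of \<B>] by auto
  have "\<forall>i\<in>{1..n}. F i \<in> \<A> i"
    using \<B> F(1) by blast
  with F(2) show "\<exists>F. (\<forall>i\<in>{1..n}. F i \<in> \<A> i) \<and> (\<Inter>i\<in>{1..n}. F i) = {}"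
    by blast
qed

theorem proposition1p2:
  fixes X :: "'a set" and \<F> :: "'a set set"
  assumes "\<F> \<subseteq> Pow X"
    and "noetherian_family \<F>"
  shows "colorful_helly_number_inf X \<F> = colorful_helly_number X \<F>"
proof -
  let ?all = "{\<A>. \<A> \<subseteq> \<F>}" and ?fin = "{\<A>. \<A> \<subseteq> \<F> \<and> finite \<A>}"
  have "colorful_helly_property X ?all n = colorful_helly_property X ?fin n" for n
  proof
    assume "colorful_helly_property X ?all n"
    then show "colorful_helly_property X ?fin n"
      by (rule colorful_helly_property_refine) blast
  next
    assume "colorful_helly_property X ?fin n"
    then show "colorful_helly_property X ?all n"
    proof (rule colorful_helly_property_refine)
      fix \<A> assume "\<A> \<in> ?all" and empty: "X \<inter> \<Inter>\<A> = {}"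
      then obtain \<B> where "\<B> \<subseteq> \<A>" "finite \<B>" "\<Inter>\<B> = \<Inter>\<A>"
        using noetherian_family_finite_subfamily[OF assms(2), of \<A>] by blast
      with \<open>\<A> \<in> ?all\<close> empty show "\<exists>\<B>\<in>?fin. \<B> \<subseteq> \<A> \<and> X \<inter> \<Inter>\<B> = {}"
        by (intro bexI[of _ \<B>]) auto
    qed
  qed
  then have "colorful_helly_property X ?all = colorful_helly_property X ?fin"
    by (rule ext)
  then show ?thesis
    by (simp add: colorful_helly_number_inf_def colorful_helly_number_def)
qed

end
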